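(* For every integer $n\ge 2$ and every $k\in\{1,\ldots,n-1\}$, there exists a connected threshold graph on $n$ vertices with minimum degree $k$.
   Context: Graphs are finite and simple. A threshold graph is a graph that can be constructed from the one-vertex graph by repeatedly applying one of the following two operations: (i) add an isolated vertex, adjacent to no existing vertex; (ii) add a dominating vertex, adjacent to all existing vertices. *)

theory Defs
  imports "Graph_Theory.Digraph_Component"
begin

text \<open>
  As in the library, a finite simple graph is a finite symmetric loop-free digraph
  (locale \<^locale>\<open>pair_graph\<close>): an edge $uv$ is represented by the two arcs
  $(u,v)$ and $(v,u)$.
\<close>

definition add_isolated :: "'a \<Rightarrow> 'a pair_pre_digraph \<Rightarrow> 'a pair_pre_digraph" where
  "add_isolated v G = \<lparr> pverts = insert v (pverts G), parcs = parcs G \<rparr>"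

definition add_dominating :: "'a \<Rightarrow> 'a pair_pre_digraph \<Rightarrow> 'a pair_pre_digraph" where
  "add_dominating v G =
     \<lparr> pverts = insert v (pverts G),
       parcs = parcs G \<union> {v} \<times> pverts G \<union> pverts G \<times> {v} \<rparr>"

inductive threshold_graph :: "'a pair_pre_digraph \<Rightarrow> bool" where
  one_vertex: "threshold_graph \<lparr> pverts = {v}, parcs = {} \<rparr>"
| isolated: "threshold_graph G \<Longrightarrow> v \<notin> pverts G \<Longrightarrow> threshold_graph (add_isolated v G)"
| dominating: "threshold_graph G \<Longrightarrow> v \<notin> pverts G \<Longrightarrow> threshold_graph (add_dominating v G)"

lemma threshold_graph_imp_pair_graph:
  assumes "threshold_graph G"
  shows "pair_graph G"
  using assms
proof induction
  case (one_vertex v)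
  show ?case by unfold_locales (auto simp: symmetric_def sym_def)
next
  case (isolated G v)
  interpret pair_graph G by fact
  have "sym (parcs G)" using pair_sym_arcs by (simp add: symmetric_def)
  then show ?case
    by unfold_locales
      (auto simp: add_isolated_def symmetric_def dest: in_arcsD1 in_arcsD2 pair_no_loops)
next
  case (dominating G v)
  interpret pair_graph G by fact
  have "sym (parcs G)" using pair_sym_arcs by (simp add: symmetric_def)
  then show ?case using dominating.hyps
    by unfold_locales
      (auto simp: add_dominating_def symmetric_def sym_def
        dest: in_arcsD1 in_arcsD2 pair_no_loops)
qed

text \<open>
  In a symmetric digraph without parallel arcs the out-degree of a vertex is its number of
  neighbours, i.e. its degree in the undirected graph. The minimum is only meaningful for
  finite graphs with at least one vertex.
\<close>

definition min_degree :: "('a, 'b) pre_digraph \<Rightarrow> nat" where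
  "min_degree G = Min (out_degree G ` verts G)"

end

theory Submission
  imports Defs
begin

text \<open>
  The witnesses are the complete split graphs: a clique on \<open>k\<close> vertices joined completely to an
  independent set on \<open>n - k\<close> vertices. As \<open>k \<le> n - 1\<close>, the independent set is non-empty, so it
  arises from the one-vertex graph by adding isolated vertices, and adding \<open>k\<close> dominating
  vertices to it then yields the clique together with all edges to the independent set
  (\<open>threshold_graph_complete_split\<close>).
  A vertex of the independent set sees exactly the clique and has degree \<open>k\<close>; a vertex of the
  clique sees all other vertices and has degree \<open>n - 1 \<ge> k\<close>. So the minimum degree is \<open>k\<close>
  (\<open>min_degree_complete_split\<close>). Since \<open>k \<ge> 1\<close>, the clique is non-empty, and any vertex of it,
  being adjacent to everything else, connects the graph (\<open>connected_if_universal_vertex\<close>).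
\<close>

text \<open>
  The independent set comes first, so that the graphs with a fixed \<open>m\<close> and growing \<open>n\<close> are
  obtained from one another by adding the dominating vertex \<open>n\<close>.
\<close>

definition complete_split :: "nat \<Rightarrow> nat \<Rightarrow> nat pair_pre_digraph" where
  "complete_split m n =
     \<lparr> pverts = {..<n},
       parcs = {(u, v). u < n \<and> v < n \<and> u \<noteq> v \<and> (m \<le> u \<or> m \<le> v)} \<rparr>"

lemma pverts_complete_split [simp]: "pverts (complete_split m n) = {..<n}"
  by (simp add: complete_split_def)

lemma parcs_complete_split [simp]:
  "(u, v) \<in> parcs (complete_split m n) \<longleftrightarrow> u < n \<and> v < n \<and> u \<noteq> v \<and> (m \<le> u \<or> m \<le> v)"
  by (simp add: complete_split_def)

lemma threshold_graph_edgeless: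
  fixes n :: nat
  assumes "n \<ge> 1"
  shows "threshold_graph \<lparr> pverts = {..<n}, parcs = {} \<rparr>"
  using assms
proof (induction n rule: dec_induct)
  case base
  then show ?case using threshold_graph.one_vertex[of 0] by (simp add: lessThan_Suc)
next
  case (step n)
  from threshold_graph.isolated[OF step.IH, of n] show ?case
    by (simp add: add_isolated_def lessThan_Suc)
qed

lemma complete_split_Suc:
  assumes "m \<le> n"
  shows "complete_split m (Suc n) = add_dominating n (complete_split m n)"
  using assms by (auto simp: complete_split_def add_dominating_def)

lemma threshold_graph_complete_split:
  assumes "1 \<le> m" "m \<le> n"
  shows "threshold_graph (complete_split m n)"
  using assms(2)
proof (induction n rule: dec_induct)
  case base
  have "complete_split m m = \<lparr> pverts = {..<m}, parcs = {} \<rparr>"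
    by (auto simp: complete_split_def)
  then show ?case using threshold_graph_edgeless[OF assms(1)] by simp
next
  case (step n)
  then show ?case by (simp add: complete_split_Suc threshold_graph.dominating)
qed

lemma out_degree_eq_card_neighbours:
  "out_degree (with_proj G) v = card {w. (v, w) \<in> parcs G}"
proof -
  have "out_arcs (with_proj G) v = Pair v ` {w. (v, w) \<in> parcs G}"
    by (auto simp: out_arcs_def)
  then show ?thesis by (simp add: out_degree_def card_image inj_on_def)
qed

lemma out_degree_complete_split:
  assumes "v < n"
  shows "out_degree (with_proj (complete_split m n)) v = (if v < m then n - m else n - 1)"
proof -
  have "{w. (v, w) \<in> parcs (complete_split m n)} = (if v < m then {m..<n} else {..<n} - {v})"
    using assms by auto
  then show ?thesis using assms by (simp add: out_degree_eq_card_neighbours)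
qed

lemma min_degree_complete_split:
  assumes "1 \<le> m" "m \<le> n"
  shows "min_degree (with_proj (complete_split m n)) = n - m"
  unfolding min_degree_def
proof (rule Min_eqI)
  fix d assume "d \<in> out_degree (with_proj (complete_split m n)) `
    verts (with_proj (complete_split m n))"
  then show "n - m \<le> d" using assms by (auto simp: out_degree_complete_split)
next
  \<comment> \<open>The vertex \<open>0\<close> lies in the independent set, as \<open>m \<ge> 1\<close>.\<close>
  have "out_degree (with_proj (complete_split m n)) 0 = n - m"
    using assms by (simp add: out_degree_complete_split)
  then show "n - m \<in> out_degree (with_proj (complete_split m n)) `
      verts (with_proj (complete_split m n))"
    using assms by (force intro: rev_image_eqI[of 0])
qed simp

text \<open>Any two vertices are joined by a walk through the universal vertex \<open>w\<close>.\<close>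

lemma connected_if_universal_vertex:
  assumes "pair_graph G" "w \<in> pverts G"
    and universal: "\<And>v. v \<in> pverts G \<Longrightarrow> v \<noteq> w \<Longrightarrow> (v, w) \<in> parcs G"
  shows "Digraph_Component.connected (with_proj G)"
proof -
  interpret pair_graph G by fact
  have to_w: "v \<rightarrow>\<^sup>*\<^bsub>with_proj G\<^esub> w" if "v \<in> pverts G" for v
    using that assms(2) universal[OF that] by (cases "v = w") auto
  have "u \<rightarrow>\<^sup>*\<^bsub>with_proj G\<^esub> v" if "u \<in> pverts G" "v \<in> pverts G" for u v
    using reachable_trans[OF to_w symmetric_reachable'[OF to_w]] that by blast
  then show ?thesis
    using assms(2) reachable_mk_symmetric_eq[OF sym_arcs]
    by (auto simp: Digraph_Component.connected_def strongly_connected_def)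
qed

theorem theorem2p7:
  fixes n k :: nat
  assumes "n \<ge> 2" and "k \<in> {1..n - 1}"
  shows "\<exists>G :: nat pair_pre_digraph.
           pair_graph G \<and> threshold_graph G \<and> Digraph_Component.connected (with_proj G) \<and>
           card (pverts G) = n \<and> min_degree (with_proj G) = k"
proof -
  let ?G = "complete_split (n - k) n"
  have m: "1 \<le> n - k" "n - k \<le> n" and k: "n - (n - k) = k" using assms by auto
  have threshold: "threshold_graph ?G" using m by (rule threshold_graph_complete_split)
  then have graph: "pair_graph ?G" by (rule threshold_graph_imp_pair_graph)
  \<comment> \<open>The vertex \<open>n - 1\<close> lies in the clique, as \<open>k \<ge> 1\<close>.\<close>
  have "Digraph_Component.connected (with_proj ?G)"
    by (rule connected_if_universal_vertex[OF graph, of "n - 1"]) (use assms in auto)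
  moreover have "min_degree (with_proj ?G) = k"
    using min_degree_complete_split[OF m] k by simp
  ultimately show ?thesis using threshold graph by (intro exI[of _ ?G]) simp
qed

end
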